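(* Let $X_1,\ldots,X_n$ be random vectors in $\mathbb{R}^p$ of the form $$X_i=Y_i+\frac{Z_i}{\sqrt{p}},$$ and let $n$ and $p$ tend to infinity. Assume the following. (i) $\mathcal{Y}_n=\{Y_i\}_{i=1}^n$ has joint distribution $P_n$; $\{Z_i\}_{i=1}^n$ are i.i.d. random vectors in $\mathbb{R}^p$ with $\mathbf{E}(Z_i)=0$; $\mathcal{Y}_n$ and $\{Z_i\}_{i=1}^n$ are independent. (ii) There are constants $C,c_0,b>0$ independent of $p$ such that for every function $F:\mathbb{R}^p\to\mathbb{R}$ that is $1$-Lipschitz with respect to the Euclidean norm, with $\mu_F=\mathbf{E}(F(Z_i))$, one has $P(|F(Z_i)-\mu_F|>r)\le C\exp(-c_0r^b)$ for all $r>0$. (iii) $\nu=\mathbf{E}(\Vert Z_i\Vert_2^2)/p$ stays bounded as $p\to\infty$. (iv) With $\mathcal{M}(\mathcal{Y}_n)=\max_{i\ne j}\Vert Y_i-Y_j\Vert_2^2$, there exist deterministic $\mathcal{M}_p$ with $P(\mathcal{M}(\mathcal{Y}_n)\le\mathcal{M}_p)\to1$ and $\varepsilon>0$ such that $$\max\left(\mathcal{M}_p^{1/2},1\right)\frac{\left(\log n+(\log n)^{\varepsilon}\right)^{1/b}}{\sqrt{p}}\to0.$$ Then $$\max_{i\neq j}\Big|\Vert X_i-X_j\Vert_2^2-\left[\Vert Y_i-Y_j\Vert_2^2+2\nu\right]\Big|\to0\quad\text{in probability}.$$ Moreover, let $\mathcal{W}(\mathcal{Y}_n)=\min_{i\ne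 j}\Vert Y_i-Y_j\Vert_2^2$ and let $\mathcal{W}_p$ be deterministic such that $P(\mathcal{W}(\mathcal{Y}_n)\ge\mathcal{W}_p)\to1$ (the choice $\mathcal{W}_p=0$ is always possible). For $\eta>0$ let $$I_p(\eta)=\left[\mathcal{W}_p+2\nu-\eta,\ \mathcal{M}_p+2\nu+\eta\right],$$ and let $\mathcal{F}_{C_1,I_p(\eta)}$ be the set of functions $f:\mathbb{R}\to\mathbb{R}$ such that $|f(x)-f(y)|\le C_1|x-y|$ for all $x,y\in I_p(\eta)$. For such $f$ let $M_f$ and $\widetilde{M}_f$ be the $n\times n$ matrices with entries $$M_f(i,j)=\frac1nf\left(\Vert X_i-X_j\Vert_2^2\right),\qquad \widetilde{M}_f(i,j)=\begin{cases}\frac1nf\left(\Vert Y_i-Y_j\Vert_2^2+2\nu\right), & i\ne j,\\ \frac1nf(0), & i=j.\end{cases}$$ Then, for any given $C_1>0$ and $\eta>0$, $$\lim_{n,p\to\infty}\ \sup_{f\in\mathcal{F}_{C_1,I_p(\eta)}}\Vert M_f-\widetilde{M}_f\Vert_F=0\quad\text{in probability}.$$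
   Context: $\Vert M\Vert_F$ denotes the Frobenius norm of a matrix and $\Vert v\Vert_2$ the Euclidean norm of a vector. Because the supremum over $f$ may fail to be measurable, its convergence to $0$ in probability means that there is a random variable that dominates it and goes to $0$ in probability (convergence in outer probability). The distributions of the $Y_i$ and $Z_i$ may vary with $n$ and $p$. *)

theory Defs
  imports "HOL-Probability.Probability"
begin

text \<open>
  The dimension \<open>p\<close> varies along the asymptotics, so a vector of \<open>\<real>\<^sup>p\<close> is an extensional
  function on \<open>{..<p}\<close>; a random vector is a measurable map into the following space, whose
  sigma-algebra is the Borel one.
\<close>

abbreviation euclid :: "nat \<Rightarrow> (nat \<Rightarrow> real) measure" where
  "euclid p \<equiv> (\<Pi>\<^sub>M j\<in>{..<p}. (borel :: real measure))"

definition sqdist :: "nat \<Rightarrow> (nat \<Rightarrow> real) \<Rightarrow> (nat \<Rightarrow> real) \<Rightarrow> real" where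
  "sqdist p x y = (L2_set (\<lambda>j. x j - y j) {..<p})\<^sup>2"

definition one_Lipschitz :: "nat \<Rightarrow> ((nat \<Rightarrow> real) \<Rightarrow> real) \<Rightarrow> bool" where
  "one_Lipschitz p F \<longleftrightarrow>
     (\<forall>x\<in>space (euclid p). \<forall>y\<in>space (euclid p).
        \<bar>F x - F y\<bar> \<le> L2_set (\<lambda>j. x j - y j) {..<p})"

definition offdiag :: "nat \<Rightarrow> (nat \<times> nat) set" where
  "offdiag n = {(i, j). i < n \<and> j < n \<and> i \<noteq> j}"

definition frobenius_norm :: "nat \<Rightarrow> (nat \<Rightarrow> nat \<Rightarrow> real) \<Rightarrow> real" where
  "frobenius_norm n A = sqrt (\<Sum>i<n. \<Sum>j<n. (A i j)\<^sup>2)"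

definition max_sqdist :: "nat \<Rightarrow> nat \<Rightarrow> (nat \<Rightarrow> nat \<Rightarrow> real) \<Rightarrow> real" where
  "max_sqdist n p y = Max ((\<lambda>(i, j). sqdist p (y i) (y j)) ` offdiag n)"

definition min_sqdist :: "nat \<Rightarrow> nat \<Rightarrow> (nat \<Rightarrow> nat \<Rightarrow> real) \<Rightarrow> real" where
  "min_sqdist n p y = Min ((\<lambda>(i, j). sqdist p (y i) (y j)) ` offdiag n)"

definition Lipschitz_class :: "real \<Rightarrow> real set \<Rightarrow> (real \<Rightarrow> real) set" where
  "Lipschitz_class C I = {f. \<forall>x\<in>I. \<forall>y\<in>I. \<bar>f x - f y\<bar> \<le> C * \<bar>x - y\<bar>}"

definition kernel_matrix ::
    "nat \<Rightarrow> nat \<Rightarrow> (real \<Rightarrow> real) \<Rightarrow> (nat \<Rightarrow> nat \<Rightarrow> real) \<Rightarrow> nat \<Rightarrow> nat \<Rightarrow> real" where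
  "kernel_matrix n p f x i j = 1 / real n * f (sqdist p (x i) (x j))"

definition kernel_matrix_approx ::
    "nat \<Rightarrow> nat \<Rightarrow> real \<Rightarrow> (real \<Rightarrow> real) \<Rightarrow> (nat \<Rightarrow> nat \<Rightarrow> real) \<Rightarrow> nat \<Rightarrow> nat \<Rightarrow> real" where
  "kernel_matrix_approx n p \<nu> f y i j =
     (if i \<noteq> j then 1 / real n * f (sqdist p (y i) (y j) + 2 * \<nu>) else 1 / real n * f 0)"

text \<open>
  Convergence in probability of a sequence whose \<open>k\<close>-th term lives on its own probability space
  \<open>M k\<close>. Values are extended reals because the supremum over a Lipschitz class is infinite at
  outcomes where some squared distance leaves the interval on which the class is constrained;
  a dominating random variable must then be infinite there as well.
\<close>

definition tendsto_0_in_prob :: "(nat \<Rightarrow> 'a measure) \<Rightarrow> (nat \<Rightarrow> 'a \<Rightarrow> ereal) \<Rightarrow> bool" where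
  "tendsto_0_in_prob M \<xi> \<longleftrightarrow>
     (\<forall>k. \<xi> k \<in> borel_measurable (M k)) \<and>
     (\<forall>e::real. e > 0 \<longrightarrow>
        (\<lambda>k. measure (M k) {\<omega> \<in> space (M k). \<bar>\<xi> k \<omega>\<bar> > ereal e}) \<longlonglongrightarrow> 0)"

text \<open>Only meant for nonnegative \<open>S\<close>, which need not be measurable.\<close>

definition tendsto_0_in_outer_prob :: "(nat \<Rightarrow> 'a measure) \<Rightarrow> (nat \<Rightarrow> 'a \<Rightarrow> ereal) \<Rightarrow> bool" where
  "tendsto_0_in_outer_prob M S \<longleftrightarrow>
     (\<exists>D. (\<forall>k. \<forall>\<omega>\<in>space (M k). S k \<omega> \<le> D k \<omega>) \<and> tendsto_0_in_prob M D)"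

end

theory Submission
  imports Defs "HOL-Real_Asymp.Real_Asymp"
begin

text \<open>
  Write \<open>Z\<^sub>i \<bullet> Z\<^sub>j\<close> for the scalar product. Expanding the square gives
  \<open>\<parallel>X\<^sub>i - X\<^sub>j\<parallel>\<^sup>2 = \<parallel>Y\<^sub>i - Y\<^sub>j\<parallel>\<^sup>2 + 2 (Y\<^sub>i - Y\<^sub>j) \<bullet> (Z\<^sub>i - Z\<^sub>j) / \<surd>p + (\<parallel>Z\<^sub>i\<parallel>\<^sup>2 + \<parallel>Z\<^sub>j\<parallel>\<^sup>2 - 2 Z\<^sub>i \<bullet> Z\<^sub>j) / p\<close>,
  and each term on the right is controlled by the concentration of a 1-Lipschitz function of a
  single noise vector.

  For a fixed nonzero vector \<open>u\<close> the map \<open>v \<mapsto> u \<bullet> v / \<parallel>u\<parallel>\<close> is 1-Lipschitz and \<open>Z\<^sub>i\<close> is centred, so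
  \<open>\<bar>u \<bullet> Z\<^sub>i\<bar> \<le> r \<parallel>u\<parallel>\<close> fails with probability at most \<open>q r = C exp (- c\<^sub>0 r\<^sup>b)\<close>. By Fubini the same bound
  holds when \<open>u\<close> is replaced by a random vector independent of \<open>Z\<^sub>i\<close> (lemma \<open>prob_dot_indep_le\<close>); this
  is used with \<open>Y\<^sub>i - Y\<^sub>j\<close> and with \<open>Z\<^sub>j\<close>. The norm is 1-Lipschitz as well, so \<open>\<parallel>Z\<^sub>i\<parallel>\<close> is within \<open>r\<close> of its
  mean \<open>\<mu>\<close> outside an event of probability at most \<open>q r\<close>. Integrating the tails bounds the variance of \<open>\<parallel>Z\<^sub>i\<parallel>\<close> by a
  constant \<open>K\<close> that does not depend on \<open>p\<close> (lemma \<open>second_moment_le_tail_sum\<close>), whence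
  \<open>\<mu>\<^sup>2 \<le> p \<nu> \<le> \<mu>\<^sup>2 + K\<close>, and \<open>\<parallel>Z\<^sub>i\<parallel>\<^sup>2 / p\<close> is close to \<open>\<nu>\<close>.

  A union bound over pairs (lemma \<open>max_deviation_prob_le\<close>) then shows that, outside an event of
  probability at most \<open>3 n\<^sup>2 q r\<close>, the maximal error is at most \<open>(4 + 6 \<surd>B) t + 4 t\<^sup>2 + 2 K / p\<close>, where \<open>B\<close> bounds \<open>\<nu>\<close> and
  \<open>t = max (\<surd>m) 1 * r / \<surd>p\<close>, on the event that all the \<open>\<parallel>Y\<^sub>i - Y\<^sub>j\<parallel>\<^sup>2\<close> are at most \<open>m\<close>. The choice
  \<open>r\<^sup>b = (3 / c\<^sub>0) ln n\<close> turns the bound \<open>3 n\<^sup>2 q r\<close> into \<open>3 C / n\<close>, and \<open>t\<close> tends to \<open>0\<close> by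
  the growth assumption on the bounds for the squared distances of the \<open>Y\<^sub>i\<close>.

  For the kernel matrices, once the maximal error is at most \<open>\<eta>\<close> and the squared distances of the
  \<open>Y\<^sub>i\<close> lie in their prescribed range, the Lipschitz condition applies to every off-diagonal entry,
  simultaneously for all \<open>f\<close> in the class, while the diagonals agree. The Frobenius norm is thus at
  most \<open>C\<^sub>1\<close> times the maximal error there; the dominating random variable is infinite elsewhere.
\<close>

section \<open>Scalar product and norm of coordinate vectors\<close>

text \<open>Only the first \<open>p\<close> coordinates of the vectors matter.\<close>

definition dot :: "nat \<Rightarrow> (nat \<Rightarrow> real) \<Rightarrow> (nat \<Rightarrow> real) \<Rightarrow> real" where
  "dot p u v = (\<Sum>l<p. u l * v l)"

text \<open>The Euclidean norm of the first \<open>p\<close> coordinates.\<close>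

abbreviation enorm :: "nat \<Rightarrow> (nat \<Rightarrow> real) \<Rightarrow> real" where
  "enorm p v \<equiv> L2_set v {..<p}"

lemma enorm_sq: "(enorm p v)\<^sup>2 = dot p v v"
  by (simp add: L2_set_def dot_def sum_nonneg power2_eq_square)

lemma abs_dot_le: "\<bar>dot p u v\<bar> \<le> enorm p u * enorm p v"
proof -
  have "\<bar>dot p u v\<bar> \<le> (\<Sum>l<p. \<bar>u l\<bar> * \<bar>v l\<bar>)"
    unfolding dot_def by (rule order_trans[OF sum_abs]) (simp add: abs_mult)
  also have "\<dots> \<le> enorm p u * enorm p v"
    by (rule L2_set_mult_ineq)
  finally show ?thesis .
qed

lemma one_Lipschitz_enorm: "one_Lipschitz p (enorm p)"
proof -
  have *: "enorm p x \<le> enorm p y + enorm p (\<lambda>j. x j - y j)" for x y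
    using L2_set_triangle_ineq[of y "\<lambda>j. x j - y j" "{..<p}"] by simp
  have sym: "enorm p (\<lambda>j. x j - y j) = enorm p (\<lambda>j. y j - x j)" for x y
    by (simp add: L2_set_def power2_commute)
  show ?thesis
    unfolding one_Lipschitz_def
  proof (intro ballI)
    fix x y
    show "\<bar>enorm p x - enorm p y\<bar> \<le> enorm p (\<lambda>j. x j - y j)"
      using *[of x y] *[of y x] sym[of x y] by linarith
  qed
qed

lemma one_Lipschitz_dot:
  assumes "enorm p u > 0"
  shows "one_Lipschitz p (\<lambda>v. dot p u v / enorm p u)"
  unfolding one_Lipschitz_def
proof (intro ballI)
  fix x y
  have "dot p u x / enorm p u - dot p u y / enorm p u = dot p u (\<lambda>j. x j - y j) / enorm p u"
    by (simp add: dot_def algebra_simps sum_subtractf diff_divide_distrib)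
  then show "\<bar>dot p u x / enorm p u - dot p u y / enorm p u\<bar> \<le> enorm p (\<lambda>j. x j - y j)"
    using abs_dot_le[of p u "\<lambda>j. x j - y j"] assms by (simp add: divide_simps mult.commute)
qed

lemma measurable_dot [measurable]:
  assumes [measurable]: "U \<in> measurable N (euclid p)" "V \<in> measurable N (euclid p)"
  shows "(\<lambda>\<omega>. dot p (U \<omega>) (V \<omega>)) \<in> borel_measurable N"
  unfolding dot_def by measurable

lemma measurable_enorm [measurable]:
  assumes [measurable]: "U \<in> measurable N (euclid p)"
  shows "(\<lambda>\<omega>. enorm p (U \<omega>)) \<in> borel_measurable N"
  unfolding L2_set_def by measurable

lemma measurable_sqdist [measurable]:
  assumes [measurable]: "U \<in> measurable N (euclid p)" "V \<in> measurable N (euclid p)"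
  shows "(\<lambda>\<omega>. sqdist p (U \<omega>) (V \<omega>)) \<in> borel_measurable N"
  unfolding sqdist_def L2_set_def by measurable

lemma finite_offdiag [simp]: "finite (offdiag n)"
  by (rule finite_subset[of _ "{..<n} \<times> {..<n}"]) (auto simp: offdiag_def)

lemma card_offdiag_le: "card (offdiag n) \<le> n\<^sup>2"
  using card_mono[of "{..<n} \<times> {..<n}" "offdiag n"]
  by (auto simp: offdiag_def power2_eq_square)

lemma sqdist_perturbed:
  assumes p: "p > 0"
    and x: "\<And>l. l < p \<Longrightarrow> x l = y l + z l / sqrt (real p)"
    and x': "\<And>l. l < p \<Longrightarrow> x' l = y' l + z' l / sqrt (real p)"
  shows "sqdist p x x' = sqdist p y y'
    + 2 / sqrt (real p) * (dot p (\<lambda>l. y l - y' l) z + dot p (\<lambda>l. y' l - y l) z')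
    + ((enorm p z)\<^sup>2 + (enorm p z')\<^sup>2 - 2 * dot p z z') / real p"
proof -
  define s where "s = sqrt (real p)"
  have s: "s > 0" "s\<^sup>2 = real p" using p by (auto simp: s_def)
  have sq: "sqdist p u v = (\<Sum>l<p. (u l - v l)\<^sup>2)" for u v
    by (simp add: sqdist_def L2_set_def sum_nonneg)
  have "(x l - x' l)\<^sup>2 = (y l - y' l)\<^sup>2
      + 2 / s * ((y l - y' l) * z l + (y' l - y l) * z' l)
      + (z l * z l + z' l * z' l - 2 * (z l * z' l)) / real p" if "l < p" for l
    unfolding x[OF that] x'[OF that] s_def[symmetric] s(2)[symmetric]
    using s(1) by (simp add: field_simps power2_eq_square)
  then have "sqdist p x x' = (\<Sum>l<p. (y l - y' l)\<^sup>2
      + 2 / s * ((y l - y' l) * z l + (y' l - y l) * z' l)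
      + (z l * z l + z' l * z' l - 2 * (z l * z' l)) / real p)"
    unfolding sq by (intro sum.cong) auto
  then show ?thesis
    unfolding enorm_sq sq
    by (simp add: dot_def sum.distrib sum_subtractf s_def[symmetric]
        sum_distrib_left[symmetric] sum_divide_distrib[symmetric])
qed

section \<open>Consequences of concentration\<close>

lemma summable_stretched_exp:
  fixes c b :: real
  assumes c: "c > 0" and b: "b > 0"
  shows "summable (\<lambda>m. (2 * real m + 1) * (C * exp (- c * real m powr b)))"
proof (rule summable_comparison_test_bigo)
  show "summable (\<lambda>m. norm (1 / real m ^ 2))"
    using inverse_power_summable[of 2, where 'a = real] by (simp add: inverse_eq_divide)
  have "(\<lambda>m. (2 * real m + 1) * exp (- c * real m powr b)) \<in> O(\<lambda>m. 1 / real m ^ 2)"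
    using c b by real_asymp
  then show "(\<lambda>m. (2 * real m + 1) * (C * exp (- c * real m powr b))) \<in> O(\<lambda>m. 1 / real m ^ 2)"
    by (cases "C = 0") (simp_all add: mult.left_commute[of _ C])
qed

context prob_space
begin

text \<open>
  The random vector \<open>V\<close> has the concentration function \<open>q\<close>: every 1-Lipschitz function of \<open>V\<close>
  deviates from its mean by more than \<open>r\<close> with probability at most \<open>q r\<close>. Only positive \<open>r\<close> are
  constrained, so \<open>q 0\<close> is arbitrary.
\<close>

definition lip_conc :: "nat \<Rightarrow> (real \<Rightarrow> real) \<Rightarrow> ('a \<Rightarrow> nat \<Rightarrow> real) \<Rightarrow> bool" where
  "lip_conc p q V \<longleftrightarrow> (\<forall>F r. one_Lipschitz p F \<longrightarrow> r > 0 \<longrightarrow>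
     prob {\<omega> \<in> space M. \<bar>F (V \<omega>) - expectation (\<lambda>\<omega>'. F (V \<omega>'))\<bar> > r} \<le> q r)"

lemma lip_concD:
  "lip_conc p q V \<Longrightarrow> one_Lipschitz p F \<Longrightarrow> r > 0 \<Longrightarrow>
     prob {\<omega> \<in> space M. \<bar>F (V \<omega>) - expectation (\<lambda>\<omega>'. F (V \<omega>'))\<bar> > r} \<le> q r"
  by (auto simp: lip_conc_def)

lemma lip_conc_nonneg: "lip_conc p q V \<Longrightarrow> r > 0 \<Longrightarrow> 0 \<le> q r"
  using lip_concD[OF _ one_Lipschitz_enorm] measure_nonneg order_trans by blast

lemma prob_dot_const_le:
  assumes conc: "lip_conc p q V"
    and int: "\<And>l. l < p \<Longrightarrow> integrable M (\<lambda>\<omega>. V \<omega> l)"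
    and mean: "\<And>l. l < p \<Longrightarrow> expectation (\<lambda>\<omega>. V \<omega> l) = 0"
    and r: "r > 0"
  shows "prob {\<omega> \<in> space M. \<bar>dot p u (V \<omega>)\<bar> > r * enorm p u} \<le> q r"
proof (cases "enorm p u = 0")
  case True
  then have "dot p u v = 0" for v using abs_dot_le[of p u v] by simp
  then show ?thesis using lip_conc_nonneg[OF conc r] True by simp
next
  case False
  then have pos: "enorm p u > 0" by (simp add: order_less_le L2_set_nonneg)
  have E: "expectation (\<lambda>\<omega>. dot p u (V \<omega>) / enorm p u) = 0"
    unfolding dot_def using int mean by (simp add: Bochner_Integration.integral_sum)
  have "prob {\<omega> \<in> space M. \<bar>dot p u (V \<omega>) / enorm p u\<bar> > r} \<le> q r"
    using lip_concD[OF conc one_Lipschitz_dot[OF pos] r] by (simp only: E diff_0_right)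
  also have "{\<omega> \<in> space M. \<bar>dot p u (V \<omega>) / enorm p u\<bar> > r}
      = {\<omega> \<in> space M. \<bar>dot p u (V \<omega>)\<bar> > r * enorm p u}"
    using pos by (auto simp: field_simps)
  finally show ?thesis .
qed

text \<open>
  Fubini for the joint distribution: a bound on the probability of every slice over a fixed value
  of \<open>U\<close> is a bound on the probability of the whole event.
\<close>

lemma prob_indep_slice_le:
  assumes indep: "indep_var S U T V"
    and A: "A \<in> sets (S \<Otimes>\<^sub>M T)"
    and slice: "\<And>u. u \<in> space S \<Longrightarrow> prob {\<omega> \<in> space M. (u, V \<omega>) \<in> A} \<le> q"
  shows "prob {\<omega> \<in> space M. (U \<omega>, V \<omega>) \<in> A} \<le> q"
proof -
  have [measurable]: "U \<in> measurable M S" "V \<in> measurable M T"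
    using indep by (auto simp: indep_var_rv1 indep_var_rv2)
  interpret V: prob_space "distr M T V" by (rule prob_space_distr) measurable
  interpret U: prob_space "distr M S U" by (rule prob_space_distr) measurable
  obtain \<omega>0 where "\<omega>0 \<in> space M" using not_empty by auto
  then have "U \<omega>0 \<in> space S" by (auto intro: measurable_space[of U M])
  from slice[OF this] have q: "q \<ge> 0" by (rule order_trans[OF measure_nonneg])
  have "emeasure M {\<omega> \<in> space M. (U \<omega>, V \<omega>) \<in> A}
      = emeasure (distr M (S \<Otimes>\<^sub>M T) (\<lambda>\<omega>. (U \<omega>, V \<omega>))) A"
    using A by (subst emeasure_distr) (auto intro!: arg_cong[where f = "emeasure M"])
  also have "distr M (S \<Otimes>\<^sub>M T) (\<lambda>\<omega>. (U \<omega>, V \<omega>)) = distr M S U \<Otimes>\<^sub>M distr M T V"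
    using indep by (simp add: indep_var_distribution_eq)
  also have "emeasure (distr M S U \<Otimes>\<^sub>M distr M T V) A
      = (\<integral>\<^sup>+ u. emeasure (distr M T V) (Pair u -` A) \<partial>distr M S U)"
    using A by (intro V.emeasure_pair_measure_alt) simp
  also have "\<dots> \<le> (\<integral>\<^sup>+ u. ennreal q \<partial>distr M S U)"
  proof (rule nn_integral_mono)
    fix u assume "u \<in> space (distr M S U)"
    then have u: "u \<in> space S" by simp
    have "emeasure (distr M T V) (Pair u -` A) = emeasure M {\<omega> \<in> space M. (u, V \<omega>) \<in> A}"
      using A by (subst emeasure_distr)
        (auto intro!: arg_cong[where f = "emeasure M"] sets_Pair1)
    also have "\<dots> \<le> ennreal q"
      using slice[OF u] by (simp add: emeasure_eq_measure ennreal_leI)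
    finally show "emeasure (distr M T V) (Pair u -` A) \<le> ennreal q" .
  qed
  also have "\<dots> = ennreal q" using U.emeasure_space_1 by (simp)
  finally show ?thesis using q by (simp add: emeasure_eq_measure)
qed

lemma prob_dot_indep_le:
  assumes indep: "indep_var (euclid p) U (euclid p) V"
    and conc: "lip_conc p q V"
    and int: "\<And>l. l < p \<Longrightarrow> integrable M (\<lambda>\<omega>. V \<omega> l)"
    and mean: "\<And>l. l < p \<Longrightarrow> expectation (\<lambda>\<omega>. V \<omega> l) = 0"
    and r: "r > 0"
  shows "prob {\<omega> \<in> space M. \<bar>dot p (U \<omega>) (V \<omega>)\<bar> > r * enorm p (U \<omega>)} \<le> q r"
proof -
  define A where "A = {w \<in> space (euclid p \<Otimes>\<^sub>M euclid p).
    \<bar>dot p (fst w) (snd w)\<bar> > r * enorm p (fst w)}"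
  have A: "A \<in> sets (euclid p \<Otimes>\<^sub>M euclid p)" unfolding A_def by measurable
  have V: "V \<omega> \<in> space (euclid p)" if "\<omega> \<in> space M" for \<omega>
    using indep_var_rv2[OF indep] that by (rule measurable_space)
  have U: "U \<omega> \<in> space (euclid p)" if "\<omega> \<in> space M" for \<omega>
    using indep_var_rv1[OF indep] that by (rule measurable_space)
  have "prob {\<omega> \<in> space M. (U \<omega>, V \<omega>) \<in> A} \<le> q r"
  proof (rule prob_indep_slice_le[OF indep A])
    fix u assume u: "u \<in> space (euclid p)"
    have "{\<omega> \<in> space M. (u, V \<omega>) \<in> A} = {\<omega> \<in> space M. \<bar>dot p u (V \<omega>)\<bar> > r * enorm p u}"
      using u V by (auto simp: A_def space_pair_measure)
    then show "prob {\<omega> \<in> space M. (u, V \<omega>) \<in> A} \<le> q r"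
      using prob_dot_const_le[OF conc int mean r] by simp
  qed
  also have "{\<omega> \<in> space M. (U \<omega>, V \<omega>) \<in> A}
      = {\<omega> \<in> space M. \<bar>dot p (U \<omega>) (V \<omega>)\<bar> > r * enorm p (U \<omega>)}"
    using U V by (auto simp: A_def space_pair_measure)
  finally show ?thesis .
qed

text \<open>
  If \<open>N\<close> is the least natural number with \<open>\<bar>W\<bar> \<le> N\<close>, then \<open>W\<^sup>2 \<le> N\<^sup>2\<close>, which is the sum of
  \<open>2 * m + 1\<close> over the \<open>m\<close> with \<open>\<bar>W\<bar> > m\<close>; take expectations. The summand for \<open>m = 0\<close>, where no tail
  bound is available, accounts for the additional \<open>1\<close>.
\<close>

lemma second_moment_le_tail_sum:
  fixes W :: "'a \<Rightarrow> real"
  assumes W [measurable]: "W \<in> borel_measurable M"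
    and tail: "\<And>r. r > 0 \<Longrightarrow> prob {\<omega> \<in> space M. \<bar>W \<omega>\<bar> > r} \<le> q r"
    and q0: "q 0 \<ge> 0"
    and sum: "summable (\<lambda>m. (2 * real m + 1) * q (real m))"
  shows "expectation (\<lambda>\<omega>. (W \<omega>)\<^sup>2) \<le> 1 + (\<Sum>m. (2 * real m + 1) * q (real m))"
proof -
  have q: "q (real m) \<ge> 0" for m
    using q0 order_trans[OF measure_nonneg tail[of "real m"]] by (cases "m = 0") auto
  let ?A = "\<lambda>m. {\<omega> \<in> space M. \<bar>W \<omega>\<bar> > real m}"
  let ?a = "\<lambda>m. (if m = 0 then 1 else 0) + (2 * real m + 1) * q (real m)"
  have pw: "ennreal ((W \<omega>)\<^sup>2) \<le> (\<Sum>m. ennreal (2 * real m + 1) * indicator (?A m) \<omega>)"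
    if \<omega>: "\<omega> \<in> space M" for \<omega>
  proof -
    define N where "N = nat \<lceil>\<bar>W \<omega>\<bar>\<rceil>"
    have "\<bar>W \<omega>\<bar> \<le> real N" unfolding N_def by linarith
    then have "(W \<omega>)\<^sup>2 \<le> (real N)\<^sup>2" by (simp add: abs_le_square_iff[symmetric])
    also have "(real N)\<^sup>2 = (\<Sum>m<N. 2 * real m + 1)"
      by (induction N) (simp_all add: power2_eq_square algebra_simps)
    finally have "ennreal ((W \<omega>)\<^sup>2) \<le> ennreal (\<Sum>m<N. 2 * real m + 1)"
      by (rule ennreal_leI)
    also have "\<dots> = (\<Sum>m<N. ennreal (2 * real m + 1))"
      by (rule sum_ennreal[symmetric]) simp
    also have "\<dots> = (\<Sum>m<N. ennreal (2 * real m + 1) * indicator (?A m) \<omega>)"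
    proof (rule sum.cong[OF refl])
      fix m assume "m \<in> {..<N}"
      then have "\<bar>W \<omega>\<bar> > real m" unfolding N_def by (simp add: less_ceiling_iff zless_nat_eq_int_zless)
      then show "ennreal (2 * real m + 1) = ennreal (2 * real m + 1) * indicator (?A m) \<omega>"
        using \<omega> by simp
    qed
    also have "\<dots> \<le> (\<Sum>m. ennreal (2 * real m + 1) * indicator (?A m) \<omega>)"
      by (rule sum_le_suminf) auto
    finally show ?thesis .
  qed
  have sum': "summable ?a"
    using sum by (intro summable_add) (auto intro: summable_finite[of "{0}"])
  have "(\<integral>\<^sup>+ \<omega>. ennreal ((W \<omega>)\<^sup>2) \<partial>M)
      \<le> (\<integral>\<^sup>+ \<omega>. (\<Sum>m. ennreal (2 * real m + 1) * indicator (?A m) \<omega>) \<partial>M)"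
    by (rule nn_integral_mono) (rule pw)
  also have "\<dots> = (\<Sum>m. ennreal (2 * real m + 1) * emeasure M (?A m))"
    by (subst nn_integral_suminf) (auto simp: nn_integral_cmult_indicator)
  also have "\<dots> \<le> (\<Sum>m. ennreal (?a m))"
  proof (rule suminf_le)
    fix m :: nat
    have "(2 * real m + 1) * prob (?A m) \<le> ?a m"
      using tail[of "real m"] q0 by (cases "m = 0") (auto intro!: add_increasing2 mult_left_mono)
    then show "ennreal (2 * real m + 1) * emeasure M (?A m) \<le> ennreal (?a m)"
      unfolding emeasure_eq_measure
      by (subst ennreal_mult'[symmetric]) (simp, rule ennreal_leI)
  qed auto
  also have "\<dots> = ennreal (\<Sum>m. ?a m)"
    using q sum' by (intro suminf_ennreal2) auto
  finally have "expectation (\<lambda>\<omega>. (W \<omega>)\<^sup>2) \<le> (\<Sum>m. ?a m)"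
    using q sum' by (intro integral_real_bounded) (auto intro: suminf_nonneg)
  also have "(\<Sum>m. ?a m) = (\<Sum>m. if m = 0 then 1 else 0) + (\<Sum>m. (2 * real m + 1) * q (real m))"
    using sum by (intro suminf_add[symmetric]) (auto intro: summable_finite[of "{0}"])
  also have "(\<Sum>m::nat. if m = 0 then 1 else 0 :: real) = 1"
    by (subst suminf_finite[of "{0}"]) auto
  finally show ?thesis .
qed

text \<open>
  The second moment of the norm exceeds the square of the mean norm by the variance of the norm,
  for which the tail sum is a bound that does not involve the dimension.
\<close>

lemma norm_mean_bounds:
  assumes V [measurable]: "V \<in> measurable M (euclid p)"
    and conc: "lip_conc p q V"
    and q0: "q 0 \<ge> 0"
    and sum: "summable (\<lambda>m. (2 * real m + 1) * q (real m))"
    and int: "integrable M (\<lambda>\<omega>. (enorm p (V \<omega>))\<^sup>2)"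
  defines "\<mu> \<equiv> expectation (\<lambda>\<omega>. enorm p (V \<omega>))"
  shows "\<mu> \<ge> 0"
    and "\<mu>\<^sup>2 \<le> expectation (\<lambda>\<omega>. (enorm p (V \<omega>))\<^sup>2)"
    and "expectation (\<lambda>\<omega>. (enorm p (V \<omega>))\<^sup>2) \<le> \<mu>\<^sup>2 + (1 + (\<Sum>m. (2 * real m + 1) * q (real m)))"
proof -
  show "\<mu> \<ge> 0" unfolding \<mu>_def by (simp add: L2_set_nonneg)
  have int1: "integrable M (\<lambda>\<omega>. enorm p (V \<omega>))"
    using int by (rule square_integrable_imp_integrable[rotated]) measurable
  have var: "variance (\<lambda>\<omega>. enorm p (V \<omega>)) = expectation (\<lambda>\<omega>. (enorm p (V \<omega>))\<^sup>2) - \<mu>\<^sup>2"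
    unfolding \<mu>_def by (rule variance_eq[OF int1 int])
  show "\<mu>\<^sup>2 \<le> expectation (\<lambda>\<omega>. (enorm p (V \<omega>))\<^sup>2)"
    using var variance_positive[of "\<lambda>\<omega>. enorm p (V \<omega>)"] by simp
  have "variance (\<lambda>\<omega>. enorm p (V \<omega>)) \<le> 1 + (\<Sum>m. (2 * real m + 1) * q (real m))"
    using lip_concD[OF conc one_Lipschitz_enorm] q0 sum
    by (intro second_moment_le_tail_sum) auto
  with var show "expectation (\<lambda>\<omega>. (enorm p (V \<omega>))\<^sup>2)
      \<le> \<mu>\<^sup>2 + (1 + (\<Sum>m. (2 * real m + 1) * q (real m)))" by simp
qed

end

section \<open>Extremes over pairs of points\<close>

text \<open>
  The largest error over pairs of distinct points, \<open>x\<close> being the perturbed points and \<open>y\<close> the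
  original ones. For \<open>n < 2\<close> this is the unspecified value \<open>Max {}\<close>, of unknown sign.
\<close>

definition max_deviation ::
    "nat \<Rightarrow> nat \<Rightarrow> real \<Rightarrow> (nat \<Rightarrow> nat \<Rightarrow> real) \<Rightarrow> (nat \<Rightarrow> nat \<Rightarrow> real) \<Rightarrow> real" where
  "max_deviation n p \<nu> x y =
     Max ((\<lambda>(i, j). \<bar>sqdist p (x i) (x j) - (sqdist p (y i) (y j) + 2 * \<nu>)\<bar>) ` offdiag n)"

lemma offdiag_nonempty: "n \<ge> 2 \<Longrightarrow> offdiag n \<noteq> {}"
proof -
  assume "n \<ge> 2"
  then have "(0, 1) \<in> offdiag n" by (simp add: offdiag_def)
  then show ?thesis by blast
qed

lemma deviation_le_max_deviation:
  assumes "i < n" "j < n" "i \<noteq> j"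
  shows "\<bar>sqdist p (x i) (x j) - (sqdist p (y i) (y j) + 2 * \<nu>)\<bar> \<le> max_deviation n p \<nu> x y"
  unfolding max_deviation_def using assms
  by (intro Max_ge finite_imageI finite_offdiag image_eqI[of _ _ "(i, j)"]) (auto simp: offdiag_def)

lemma measurable_max_sqdist:
  assumes "\<And>i. i < n \<Longrightarrow> Y i \<in> measurable N (euclid p)"
  shows "(\<lambda>\<omega>. max_sqdist n p (\<lambda>i. Y i \<omega>)) \<in> borel_measurable N"
  unfolding max_sqdist_def
proof (intro borel_measurable_Max finite_offdiag)
  fix a assume "a \<in> offdiag n"
  then show "(\<lambda>\<omega>. case a of (i, j) \<Rightarrow> sqdist p (Y i \<omega>) (Y j \<omega>)) \<in> borel_measurable N"
    using assms by (auto simp: offdiag_def)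
qed

lemma measurable_min_sqdist:
  assumes "\<And>i. i < n \<Longrightarrow> Y i \<in> measurable N (euclid p)"
  shows "(\<lambda>\<omega>. min_sqdist n p (\<lambda>i. Y i \<omega>)) \<in> borel_measurable N"
  unfolding min_sqdist_def
proof (intro borel_measurable_Min finite_offdiag)
  fix a assume "a \<in> offdiag n"
  then show "(\<lambda>\<omega>. case a of (i, j) \<Rightarrow> sqdist p (Y i \<omega>) (Y j \<omega>)) \<in> borel_measurable N"
    using assms by (auto simp: offdiag_def)
qed

lemma measurable_max_deviation:
  assumes X: "\<And>i. i < n \<Longrightarrow> X i \<in> measurable N (euclid p)"
    and Y: "\<And>i. i < n \<Longrightarrow> Y i \<in> measurable N (euclid p)"
  shows "(\<lambda>\<omega>. max_deviation n p \<nu> (\<lambda>i. X i \<omega>) (\<lambda>i. Y i \<omega>)) \<in> borel_measurable N"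
  unfolding max_deviation_def
proof (intro borel_measurable_Max finite_offdiag)
  fix a assume "a \<in> offdiag n"
  then obtain i j where a: "a = (i, j)" "i < n" "j < n" by (auto simp: offdiag_def)
  note [measurable] = X[OF a(2)] X[OF a(3)] Y[OF a(2)] Y[OF a(3)]
  show "(\<lambda>\<omega>. case a of (i, j) \<Rightarrow> \<bar>sqdist p (X i \<omega>) (X j \<omega>)
      - (sqdist p (Y i \<omega>) (Y j \<omega>) + 2 * \<nu>)\<bar>) \<in> borel_measurable N"
    unfolding a(1) prod.case by measurable
qed

lemma sqdist_le_max_sqdist:
  assumes "i < n" "j < n" "i \<noteq> j"
  shows "sqdist p (y i) (y j) \<le> max_sqdist n p y"
  unfolding max_sqdist_def using assms
  by (intro Max_ge finite_imageI finite_offdiag image_eqI[of _ _ "(i, j)"]) (auto simp: offdiag_def)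

lemma min_sqdist_le_sqdist:
  assumes "i < n" "j < n" "i \<noteq> j"
  shows "min_sqdist n p y \<le> sqdist p (y i) (y j)"
  unfolding min_sqdist_def using assms
  by (intro Min_le finite_imageI finite_offdiag image_eqI[of _ _ "(i, j)"]) (auto simp: offdiag_def)

lemma max_deviation_nonneg:
  assumes "n \<ge> 2"
  shows "max_deviation n p \<nu> x y \<ge> 0"
  using deviation_le_max_deviation[of 0 n 1 p x y \<nu>] assms by force

lemma max_deviation_le:
  assumes "n \<ge> 2"
    and "\<And>i j. i < n \<Longrightarrow> j < n \<Longrightarrow> i \<noteq> j \<Longrightarrow>
      \<bar>sqdist p (x i) (x j) - (sqdist p (y i) (y j) + 2 * \<nu>)\<bar> \<le> \<delta>"
  shows "max_deviation n p \<nu> x y \<le> \<delta>"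
  unfolding max_deviation_def
proof (rule Max.boundedI)
  fix d
  assume "d \<in> (\<lambda>(i, j). \<bar>sqdist p (x i) (x j) - (sqdist p (y i) (y j) + 2 * \<nu>)\<bar>) ` offdiag n"
  then show "d \<le> \<delta>" using assms(2) by (auto simp: offdiag_def)
qed (use offdiag_nonempty[OF assms(1)] in simp_all)

section \<open>Deterministic bounds on the good event\<close>

lemma abs_sq_diff_le:
  fixes a \<mu> r :: real
  assumes "\<bar>a - \<mu>\<bar> \<le> r" "a \<ge> 0" "\<mu> \<ge> 0"
  shows "\<bar>a\<^sup>2 - \<mu>\<^sup>2\<bar> \<le> r * (2 * \<mu> + r)"
proof -
  have "\<bar>a\<^sup>2 - \<mu>\<^sup>2\<bar> = \<bar>a - \<mu>\<bar> * (a + \<mu>)"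
    using assms by (simp add: power2_eq_square square_diff_square_factored abs_mult)
  also have "\<dots> \<le> r * (2 * \<mu> + r)"
    using assms by (intro mult_mono) auto
  finally show ?thesis .
qed

text \<open>
  Here \<open>\<mu>\<close> and \<open>\<mu>'\<close> stand for the mean norms of the two noise vectors, \<open>p * \<nu>\<close> for their common
  second moment and \<open>K\<close> for a bound on the variances of the norms. All the error terms are expressed
  through the one small parameter \<open>t\<close>, except for the contribution \<open>2 * K / p\<close> of the variances.
\<close>

lemma sqdist_deviation_le:
  fixes \<nu> B K L r \<mu> \<mu>' :: real and x y z x' y' z' :: "nat \<Rightarrow> real"
  assumes p: "p > 0"
    and x: "\<And>l. l < p \<Longrightarrow> x l = y l + z l / sqrt (real p)"
    and x': "\<And>l. l < p \<Longrightarrow> x' l = y' l + z' l / sqrt (real p)"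
    and L: "enorm p (\<lambda>l. y l - y' l) \<le> L" "1 \<le> L"
    and r: "r > 0"
    and yz: "\<bar>dot p (\<lambda>l. y l - y' l) z\<bar> \<le> r * enorm p (\<lambda>l. y l - y' l)"
    and yz': "\<bar>dot p (\<lambda>l. y' l - y l) z'\<bar> \<le> r * enorm p (\<lambda>l. y' l - y l)"
    and z: "\<bar>enorm p z - \<mu>\<bar> \<le> r" "\<mu> \<ge> 0" "\<mu>\<^sup>2 \<le> real p * \<nu>" "real p * \<nu> \<le> \<mu>\<^sup>2 + K"
    and z': "\<bar>enorm p z' - \<mu>'\<bar> \<le> r" "\<mu>' \<ge> 0" "\<mu>'\<^sup>2 \<le> real p * \<nu>" "real p * \<nu> \<le> \<mu>'\<^sup>2 + K"
    and zz': "\<bar>dot p z z'\<bar> \<le> r * enorm p z"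
    and B: "\<nu> \<le> B"
  defines "t \<equiv> L * r / sqrt (real p)"
  shows "\<bar>sqdist p x x' - (sqdist p y y' + 2 * \<nu>)\<bar>
    \<le> (4 + 6 * sqrt B) * t + 4 * t\<^sup>2 + 2 * K / real p"
proof -
  define s where "s = sqrt (real p)"
  have s: "s > 0" "real p = s\<^sup>2" using p by (auto simp: s_def)
  have mu_le: "m \<le> s * sqrt B" if "m \<ge> 0" "m\<^sup>2 \<le> real p * \<nu>" for m
  proof -
    have "m\<^sup>2 \<le> real p * B" using that(2) B by (meson mult_left_mono of_nat_0_le_iff order_trans)
    then have "sqrt (m\<^sup>2) \<le> sqrt (real p * B)" by (rule real_sqrt_le_mono)
    then show ?thesis using that(1) by (simp add: real_sqrt_mult s_def)
  qed
  note \<mu> = mu_le[OF z(2,3)] and \<mu>' = mu_le[OF z'(2,3)]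
  have cross: "\<bar>dot p (\<lambda>l. y l - y' l) z + dot p (\<lambda>l. y' l - y l) z'\<bar> \<le> 2 * (r * L)"
  proof -
    have "enorm p (\<lambda>l. y' l - y l) = enorm p (\<lambda>l. y l - y' l)"
      by (simp add: L2_set_def power2_commute)
    then have "\<bar>dot p (\<lambda>l. y' l - y l) z'\<bar> \<le> r * L" "\<bar>dot p (\<lambda>l. y l - y' l) z\<bar> \<le> r * L"
      using yz yz' mult_left_mono[OF L(1), of r] r by (simp, linarith)+
    then show ?thesis by linarith
  qed
  have sq: "\<bar>(enorm p w)\<^sup>2 - real p * \<nu>\<bar> \<le> r * (2 * (s * sqrt B) + r) + K"
    if "\<bar>enorm p w - m\<bar> \<le> r" "m \<ge> 0" "m\<^sup>2 \<le> real p * \<nu>" "real p * \<nu> \<le> m\<^sup>2 + K" for w m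
  proof -
    have "r * (2 * m + r) \<le> r * (2 * (s * sqrt B) + r)"
      using mu_le[OF that(2,3)] r by (intro mult_left_mono) auto
    then show ?thesis
      using abs_sq_diff_le[OF that(1) L2_set_nonneg that(2)] that(3,4) by linarith
  qed
  have zz: "\<bar>dot p z z'\<bar> \<le> r * (s * sqrt B + r)"
    using zz' mult_left_mono[of "enorm p z" "s * sqrt B + r" r] z(1) \<mu> r by linarith
  have perturbed: "sqdist p x x' = sqdist p y y'
      + 2 / s * (dot p (\<lambda>l. y l - y' l) z + dot p (\<lambda>l. y' l - y l) z')
      + ((enorm p z)\<^sup>2 + (enorm p z')\<^sup>2 - 2 * dot p z z') / real p"
    unfolding s_def using p x x' by (rule sqdist_perturbed)
  have quad: "\<bar>((enorm p z)\<^sup>2 - real p * \<nu>) + ((enorm p z')\<^sup>2 - real p * \<nu>) - 2 * dot p z z'\<bar>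
      \<le> 2 * (r * (2 * (s * sqrt B) + r) + K) + 2 * (r * (s * sqrt B + r))"
  proof -
    have "\<bar>a + b - 2 * d\<bar> \<le> 2 * u + 2 * v" if "\<bar>a\<bar> \<le> u" "\<bar>b\<bar> \<le> u" "\<bar>d\<bar> \<le> v"
      for a b d u v :: real
      using that by linarith
    from this[OF sq[OF z] sq[OF z'] zz] show ?thesis .
  qed
  have "sqdist p x x' - (sqdist p y y' + 2 * \<nu>)
      = 2 / s * (dot p (\<lambda>l. y l - y' l) z + dot p (\<lambda>l. y' l - y l) z')
        + (((enorm p z)\<^sup>2 - real p * \<nu>) + ((enorm p z')\<^sup>2 - real p * \<nu>) - 2 * dot p z z') / real p"
    unfolding perturbed using p by (simp add: add_divide_distrib diff_divide_distrib)
  also have "\<bar>\<dots>\<bar> \<le> 2 / s * (2 * (r * L))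
      + (2 * (r * (2 * (s * sqrt B) + r) + K) + 2 * (r * (s * sqrt B + r))) / real p"
  proof (intro order_trans[OF abs_triangle_ineq] add_mono)
    show "\<bar>2 / s * (dot p (\<lambda>l. y l - y' l) z + dot p (\<lambda>l. y' l - y l) z')\<bar> \<le> 2 / s * (2 * (r * L))"
      unfolding abs_mult using s(1) cross by (intro mult_mono) auto
    show "\<bar>(((enorm p z)\<^sup>2 - real p * \<nu>) + ((enorm p z')\<^sup>2 - real p * \<nu>) - 2 * dot p z z') / real p\<bar>
      \<le> (2 * (r * (2 * (s * sqrt B) + r) + K) + 2 * (r * (s * sqrt B + r))) / real p"
      unfolding abs_divide abs_of_nat using quad by (rule divide_right_mono) simp
  qed
  also have "\<dots> = 4 * t + 6 * sqrt B * (r / s) + 4 * (r / s)\<^sup>2 + 2 * K / real p"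
    unfolding t_def s_def[symmetric] using s by (simp add: field_simps power2_eq_square)
  also have "\<dots> \<le> 4 * t + 6 * sqrt B * t + 4 * t\<^sup>2 + 2 * K / real p"
  proof -
    (* The assumption 1 \<le> L lets t absorb the terms in which L does not occur. *)
    have "r / s \<le> t"
      unfolding t_def s_def[symmetric] using s(1) r L(2) by (simp add: divide_right_mono)
    moreover have "0 \<le> r / s" using r s(1) by simp
    moreover have "0 \<le> sqrt B"
      using B z(3) p by (smt (verit) real_sqrt_ge_zero zero_le_mult_iff zero_le_power2 of_nat_0_less_iff)
    ultimately show ?thesis
      by (intro add_mono mult_left_mono power_mono) auto
  qed
  finally show ?thesis by (simp add: algebra_simps)
qed

text \<open>
  Off the diagonal, the hypotheses keep both arguments of \<open>f\<close> in the interval on which it is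
  constrained, so each entry is at most \<open>C / n\<close> times the deviation; on the diagonal it vanishes. The absolute value in the conclusion covers the case
  \<open>n < 2\<close>, in which the left-hand side is \<open>0\<close>.
\<close>

lemma frobenius_kernel_diff_le:
  assumes dev: "max_deviation n p \<nu> x y \<le> \<eta>"
    and W: "w \<le> min_sqdist n p y"
    and m: "max_sqdist n p y \<le> m"
    and f: "f \<in> Lipschitz_class C {w + 2 * \<nu> - \<eta> .. m + 2 * \<nu> + \<eta>}"
    and C: "C > 0"
  shows "frobenius_norm n (\<lambda>i j. kernel_matrix n p f x i j - kernel_matrix_approx n p \<nu> f y i j)
    \<le> C * \<bar>max_deviation n p \<nu> x y\<bar>"
proof -
  let ?\<Delta> = "max_deviation n p \<nu> x y"
  let ?A = "\<lambda>i j. kernel_matrix n p f x i j - kernel_matrix_approx n p \<nu> f y i j"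
  have entry: "\<bar>?A i j\<bar> \<le> C * \<bar>?\<Delta>\<bar> / real n" if "i < n" "j < n" for i j
  proof (cases "i = j")
    case True
    then show ?thesis using C
      by (simp add: kernel_matrix_def kernel_matrix_approx_def sqdist_def L2_set_def)
  next
    case False
    let ?a = "sqdist p (x i) (x j)" and ?b = "sqdist p (y i) (y j) + 2 * \<nu>"
    have d: "\<bar>?a - ?b\<bar> \<le> ?\<Delta>"
      using deviation_le_max_deviation that False by blast
    have "?a \<in> {w + 2 * \<nu> - \<eta> .. m + 2 * \<nu> + \<eta>}" "?b \<in> {w + 2 * \<nu> - \<eta> .. m + 2 * \<nu> + \<eta>}"
      using d dev W m sqdist_le_max_sqdist[OF that False, of p y]
        min_sqdist_le_sqdist[OF that False, of p y] by auto
    then have "\<bar>f ?a - f ?b\<bar> \<le> C * \<bar>?a - ?b\<bar>"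
      using f unfolding Lipschitz_class_def by blast
    also have "\<dots> \<le> C * \<bar>?\<Delta>\<bar>" using d C by (intro mult_left_mono) auto
    finally have "\<bar>f ?a - f ?b\<bar> / real n \<le> C * \<bar>?\<Delta>\<bar> / real n"
      by (rule divide_right_mono) simp
    moreover have "?A i j = (f ?a - f ?b) / real n"
      using False by (simp add: kernel_matrix_def kernel_matrix_approx_def diff_divide_distrib)
    ultimately show ?thesis by simp
  qed
  have "(\<Sum>i<n. \<Sum>j<n. (?A i j)\<^sup>2) \<le> (\<Sum>i<n. \<Sum>j<n. (C * \<bar>?\<Delta>\<bar> / real n)\<^sup>2)"
  proof (intro sum_mono)
    fix i j assume "i \<in> {..<n}" "j \<in> {..<n}"
    then have "\<bar>?A i j\<bar>\<^sup>2 \<le> (C * \<bar>?\<Delta>\<bar> / real n)\<^sup>2" by (intro power_mono entry) auto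
    then show "(?A i j)\<^sup>2 \<le> (C * \<bar>?\<Delta>\<bar> / real n)\<^sup>2" by simp
  qed
  also have "\<dots> \<le> (C * \<bar>?\<Delta>\<bar>)\<^sup>2"
    by (cases "n = 0") (simp_all add: power_divide power2_eq_square)
  finally have "sqrt (\<Sum>i<n. \<Sum>j<n. (?A i j)\<^sup>2) \<le> sqrt ((C * \<bar>?\<Delta>\<bar>)\<^sup>2)"
    by (rule real_sqrt_le_mono)
  then show ?thesis using C by (simp add: frobenius_norm_def)
qed

section \<open>The deviation inequality for fixed \<open>n\<close> and \<open>p\<close>\<close>

text \<open>
  A union bound over the ordered pairs of points. The factor \<open>3\<close> counts the three events attached
  to each pair: the product of \<open>Y i - Y j\<close> with \<open>Z i\<close>, the norm of \<open>Z i\<close>, and the product of \<open>Z i\<close>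
  with \<open>Z j\<close>. The product of \<open>Y i - Y j\<close> with \<open>Z j\<close> is, up to sign, the first event for the
  reversed pair.
\<close>

lemma (in prob_space) max_deviation_prob_le:
  fixes X Y Z :: "nat \<Rightarrow> 'a \<Rightarrow> nat \<Rightarrow> real"
    and m :: real
  assumes n: "n \<ge> 2" and p: "p > 0"
    and X: "\<And>i l \<omega>. i < n \<Longrightarrow> \<omega> \<in> space M \<Longrightarrow> l < p \<Longrightarrow>
      X i \<omega> l = Y i \<omega> l + Z i \<omega> l / sqrt (real p)"
    and Y_meas: "\<And>i. i < n \<Longrightarrow> Y i \<in> measurable M (euclid p)"
    and Z_meas: "\<And>i. i < n \<Longrightarrow> Z i \<in> measurable M (euclid p)"
    and YZ: "\<And>i j. i < n \<Longrightarrow> j < n \<Longrightarrow>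
      indep_var (euclid p) (\<lambda>\<omega>. \<lambda>l\<in>{..<p}. Y i \<omega> l - Y j \<omega> l) (euclid p) (Z i)"
    and ZZ: "\<And>i j. i < n \<Longrightarrow> j < n \<Longrightarrow> i \<noteq> j \<Longrightarrow> indep_var (euclid p) (Z i) (euclid p) (Z j)"
    and conc: "\<And>i. i < n \<Longrightarrow> lip_conc p q (Z i)"
    and int: "\<And>i l. i < n \<Longrightarrow> l < p \<Longrightarrow> integrable M (\<lambda>\<omega>. Z i \<omega> l)"
    and mean: "\<And>i l. i < n \<Longrightarrow> l < p \<Longrightarrow> expectation (\<lambda>\<omega>. Z i \<omega> l) = 0"
    and int2: "\<And>i. i < n \<Longrightarrow> integrable M (\<lambda>\<omega>. (enorm p (Z i \<omega>))\<^sup>2)"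
    and \<nu>: "\<And>i. i < n \<Longrightarrow> expectation (\<lambda>\<omega>. (enorm p (Z i \<omega>))\<^sup>2) = real p * \<nu>"
    and B: "\<nu> \<le> B"
    and q0: "q 0 \<ge> 0"
    and sum: "summable (\<lambda>m. (2 * real m + 1) * q (real m))"
    and r: "r > 0"
  defines "K \<equiv> 1 + (\<Sum>m. (2 * real m + 1) * q (real m))"
    and "t \<equiv> max (sqrt m) 1 * r / sqrt (real p)"
  shows "prob {\<omega> \<in> space M. max_deviation n p \<nu> (\<lambda>i. X i \<omega>) (\<lambda>i. Y i \<omega>)
        > (4 + 6 * sqrt B) * t + 4 * t\<^sup>2 + 2 * K / real p}
    \<le> prob {\<omega> \<in> space M. \<not> max_sqdist n p (\<lambda>i. Y i \<omega>) \<le> m} + 3 * (real n)\<^sup>2 * q r"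
proof -
  define \<mu> where "\<mu> i = expectation (\<lambda>\<omega>. enorm p (Z i \<omega>))" for i
  define L where "L = max (sqrt m) 1"
  let ?D = "\<lambda>i j \<omega>. \<lambda>l\<in>{..<p}. Y i \<omega> l - Y j \<omega> l"
  define E0 where "E0 = {\<omega> \<in> space M. \<not> max_sqdist n p (\<lambda>i. Y i \<omega>) \<le> m}"
  define E1 where "E1 = (\<lambda>(i, j). {\<omega> \<in> space M. \<bar>dot p (?D i j \<omega>) (Z i \<omega>)\<bar> > r * enorm p (?D i j \<omega>)})"
  define E2 where "E2 = (\<lambda>(i, j::nat). {\<omega> \<in> space M. \<bar>enorm p (Z i \<omega>) - \<mu> i\<bar> > r})"
  define E3 where "E3 = (\<lambda>(i, j). {\<omega> \<in> space M. \<bar>dot p (Z i \<omega>) (Z j \<omega>)\<bar> > r * enorm p (Z i \<omega>)})"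
  have D_meas: "?D i j \<in> measurable M (euclid p)" if "i < n" "j < n" for i j
    using indep_var_rv1[OF YZ[OF that]] .
  have E0_sets: "E0 \<in> events"
    using measurable_max_sqdist[OF Y_meas] unfolding E0_def by measurable
  have sets: "E1 a \<in> events" "E2 a \<in> events" "E3 a \<in> events" if "a \<in> offdiag n" for a
  proof -
    obtain i j where a: "a = (i, j)" "i < n" "j < n" using \<open>a \<in> offdiag n\<close> by (auto simp: offdiag_def)
    note [measurable] = Z_meas[OF a(2)] Z_meas[OF a(3)] D_meas[OF a(2,3)]
    show "E1 a \<in> events" "E2 a \<in> events" "E3 a \<in> events"
      unfolding E1_def E2_def E3_def a(1) prod.case by measurable
  qed
  have le: "prob (E1 a) \<le> q r" "prob (E2 a) \<le> q r" "prob (E3 a) \<le> q r" if "a \<in> offdiag n" for a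
  proof -
    obtain i j where a: "a = (i, j)" "i < n" "j < n" "i \<noteq> j"
      using \<open>a \<in> offdiag n\<close> by (auto simp: offdiag_def)
    show "prob (E1 a) \<le> q r" unfolding E1_def a(1) prod.case
      using a by (intro prob_dot_indep_le[OF YZ conc int mean r]) auto
    show "prob (E2 a) \<le> q r" unfolding E2_def \<mu>_def a(1) prod.case
      using lip_concD[OF conc[OF a(2)] one_Lipschitz_enorm r] .
    show "prob (E3 a) \<le> q r" unfolding E3_def a(1) prod.case
      using a by (intro prob_dot_indep_le[OF ZZ conc int mean r]) auto
  qed
  let ?U = "\<Union>a\<in>offdiag n. E1 a \<union> E2 a \<union> E3 a"
  have U_sets: "?U \<in> events" using sets by (intro sets.finite_UN) auto
  have "{\<omega> \<in> space M. max_deviation n p \<nu> (\<lambda>i. X i \<omega>) (\<lambda>i. Y i \<omega>)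
      > (4 + 6 * sqrt B) * t + 4 * t\<^sup>2 + 2 * K / real p} \<subseteq> E0 \<union> ?U"
  proof (rule subsetI, rule ccontr)
    fix \<omega>
    assume "\<omega> \<in> {\<omega> \<in> space M. max_deviation n p \<nu> (\<lambda>i. X i \<omega>) (\<lambda>i. Y i \<omega>)
      > (4 + 6 * sqrt B) * t + 4 * t\<^sup>2 + 2 * K / real p}"
    then have \<omega>: "\<omega> \<in> space M" and big: "max_deviation n p \<nu> (\<lambda>i. X i \<omega>) (\<lambda>i. Y i \<omega>)
      > (4 + 6 * sqrt B) * t + 4 * t\<^sup>2 + 2 * K / real p" by auto
    assume "\<omega> \<notin> E0 \<union> ?U"
    then have good: "\<omega> \<notin> E0" "\<And>a. a \<in> offdiag n \<Longrightarrow> \<omega> \<notin> E1 a \<and> \<omega> \<notin> E2 a \<and> \<omega> \<notin> E3 a" by auto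
    have "max_deviation n p \<nu> (\<lambda>i. X i \<omega>) (\<lambda>i. Y i \<omega>)
      \<le> (4 + 6 * sqrt B) * t + 4 * t\<^sup>2 + 2 * K / real p"
    proof (rule max_deviation_le[OF n])
      fix i j assume ij: "i < n" "j < n" "i \<noteq> j"
      have D: "dot p (?D i' j' \<omega>) v = dot p (\<lambda>l. Y i' \<omega> l - Y j' \<omega> l) v"
        "enorm p (?D i' j' \<omega>) = enorm p (\<lambda>l. Y i' \<omega> l - Y j' \<omega> l)" for i' j' v
        by (simp_all add: dot_def L2_set_def)
      have g: "\<bar>dot p (\<lambda>l. Y i' \<omega> l - Y j' \<omega> l) (Z i' \<omega>)\<bar> \<le> r * enorm p (\<lambda>l. Y i' \<omega> l - Y j' \<omega> l)"
        "\<bar>enorm p (Z i' \<omega>) - \<mu> i'\<bar> \<le> r"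
        "\<bar>dot p (Z i' \<omega>) (Z j' \<omega>)\<bar> \<le> r * enorm p (Z i' \<omega>)"
        if "i' < n" "j' < n" "i' \<noteq> j'" for i' j'
        using good(2)[of "(i', j')"] that \<omega>
        unfolding E1_def E2_def E3_def offdiag_def prod.case by (auto simp: D)
      have "(enorm p (\<lambda>l. Y i \<omega> l - Y j \<omega> l))\<^sup>2 \<le> m"
        using sqdist_le_max_sqdist[OF ij, of p "\<lambda>i. Y i \<omega>"] good(1) \<omega>
        unfolding E0_def sqdist_def by auto
      then have L: "enorm p (\<lambda>l. Y i \<omega> l - Y j \<omega> l) \<le> L"
        unfolding L_def by (simp add: real_le_rsqrt max.coboundedI1)
      have \<mu>: "\<mu> i' \<ge> 0" "(\<mu> i')\<^sup>2 \<le> real p * \<nu>" "real p * \<nu> \<le> (\<mu> i')\<^sup>2 + K" if "i' < n" for i'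
        using norm_mean_bounds[OF Z_meas[OF that] conc[OF that] q0 sum int2[OF that]]
        unfolding \<mu>_def K_def \<nu>[OF that] by auto
      show "\<bar>sqdist p (X i \<omega>) (X j \<omega>) - (sqdist p (Y i \<omega>) (Y j \<omega>) + 2 * \<nu>)\<bar>
          \<le> (4 + 6 * sqrt B) * t + 4 * t\<^sup>2 + 2 * K / real p"
        unfolding t_def L_def[symmetric]
      proof (rule sqdist_deviation_le[where \<mu> = "\<mu> i" and \<mu>' = "\<mu> j"
            and z = "Z i \<omega>" and z' = "Z j \<omega>", OF p _ _ L _ r])
        show "1 \<le> L" by (simp add: L_def)
      qed (use ij \<omega> X g \<mu> B in auto)
    qed
    with big show False by simp
  qed
  then have "prob {\<omega> \<in> space M. max_deviation n p \<nu> (\<lambda>i. X i \<omega>) (\<lambda>i. Y i \<omega>)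
      > (4 + 6 * sqrt B) * t + 4 * t\<^sup>2 + 2 * K / real p} \<le> prob (E0 \<union> ?U)"
    using E0_sets U_sets by (intro finite_measure_mono) auto
  also have "\<dots> \<le> prob E0 + prob ?U"
    using E0_sets U_sets by (rule measure_Un_le)
  also have "prob ?U \<le> (\<Sum>a\<in>offdiag n. prob (E1 a \<union> E2 a \<union> E3 a))"
    using sets by (intro measure_UNION_le) auto
  also have "\<dots> \<le> (\<Sum>a\<in>offdiag n. 3 * q r)"
  proof (rule sum_mono)
    fix a assume a: "a \<in> offdiag n"
    have "prob (E1 a \<union> E2 a \<union> E3 a) \<le> prob (E1 a \<union> E2 a) + prob (E3 a)"
      using sets[OF a] by (intro measure_Un_le) auto
    also have "prob (E1 a \<union> E2 a) \<le> prob (E1 a) + prob (E2 a)"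
      using sets[OF a] by (intro measure_Un_le) auto
    finally show "prob (E1 a \<union> E2 a \<union> E3 a) \<le> 3 * q r" using le[OF a] by linarith
  qed
  also have "\<dots> \<le> (real n)\<^sup>2 * (3 * q r)"
  proof -
    have "real (card (offdiag n)) \<le> (real n)\<^sup>2"
      using card_offdiag_le[of n] by (metis of_nat_le_iff of_nat_power)
    moreover have "q r \<ge> 0" using lip_conc_nonneg[OF conc[of 0] r] n by simp
    ultimately show ?thesis by (simp add: mult_right_mono)
  qed
  finally show ?thesis unfolding E0_def by (simp add: algebra_simps)
qed

section \<open>Independence of the vectors entering the scalar products\<close>

lemma (in prob_space) indep_var_pair:
  assumes "indep_vars (\<lambda>_. N) Z I" "i \<in> I" "j \<in> I" "i \<noteq> j"
  shows "indep_var N (Z i) N (Z j)"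
proof -
  have "indep_var N ((\<lambda>f. f i) \<circ> (\<lambda>\<omega>. \<lambda>i\<in>{i}. Z i \<omega>)) N ((\<lambda>f. f j) \<circ> (\<lambda>\<omega>. \<lambda>i\<in>{j}. Z i \<omega>))"
    using assms by (intro indep_var_compose[OF indep_var_restrict[of "\<lambda>_. N" Z I "{i}" "{j}"]]) auto
  then show ?thesis by (simp add: comp_def)
qed

lemma (in prob_space) indep_var_diff_component:
  assumes indep: "indep_var (\<Pi>\<^sub>M i\<in>I. euclid p) (\<lambda>\<omega>. \<lambda>i\<in>I. Y i \<omega>) (\<Pi>\<^sub>M i\<in>I. euclid p) (\<lambda>\<omega>. \<lambda>i\<in>I. Z i \<omega>)"
    and I: "i \<in> I" "j \<in> I" "k \<in> I"
  shows "indep_var (euclid p) (\<lambda>\<omega>. \<lambda>l\<in>{..<p}. Y i \<omega> l - Y j \<omega> l) (euclid p) (Z k)"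
proof -
  let ?d = "\<lambda>f::_ \<Rightarrow> nat \<Rightarrow> real. \<lambda>l\<in>{..<p}. f i l - f j l"
  have d: "?d \<in> measurable (\<Pi>\<^sub>M i\<in>I. euclid p) (euclid p)"
  proof (rule measurable_restrict)
    fix l assume l: "l \<in> {..<p}"
    have "(\<lambda>f. f a l) \<in> borel_measurable (\<Pi>\<^sub>M i\<in>I. euclid p)" if "a \<in> I" for a
      using measurable_compose[OF measurable_component_singleton[OF that, of "\<lambda>_. euclid p"]
          measurable_component_singleton[OF l, of "\<lambda>_. borel"]] .
    with I show "(\<lambda>f. f i l - f j l) \<in> borel_measurable (\<Pi>\<^sub>M i\<in>I. euclid p)"
      by (intro borel_measurable_diff) auto
  qed
  have "indep_var (euclid p) (?d \<circ> (\<lambda>\<omega>. \<lambda>i\<in>I. Y i \<omega>)) (euclid p) ((\<lambda>f. f k) \<circ> (\<lambda>\<omega>. \<lambda>i\<in>I. Z i \<omega>))"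
    using I by (intro indep_var_compose[OF indep d]) auto
  then show ?thesis using I by (simp add: comp_def)
qed

section \<open>Convergence in probability\<close>

lemma tendsto_0_in_probI:
  assumes meas: "\<And>k. \<xi> k \<in> borel_measurable (M k)"
    and g: "g \<longlonglongrightarrow> 0"
    and le: "\<And>e. e > 0 \<Longrightarrow> eventually (\<lambda>k.
      measure (M k) {\<omega> \<in> space (M k). \<bar>\<xi> k \<omega>\<bar> > ereal e} \<le> g k) sequentially"
  shows "tendsto_0_in_prob M \<xi>"
  unfolding tendsto_0_in_prob_def
proof (intro conjI allI impI)
  fix e :: real assume e: "e > 0"
  show "(\<lambda>k. measure (M k) {\<omega> \<in> space (M k). \<bar>\<xi> k \<omega>\<bar> > ereal e}) \<longlonglongrightarrow> 0"
    by (rule Lim_null_comparison[OF _ g]) (use le[OF e] in simp)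
qed (rule meas)

theorem corollary2p3:
  fixes M :: "nat \<Rightarrow> 'a measure"
    and n p :: "nat \<Rightarrow> nat"
    and X Y Z :: "nat \<Rightarrow> nat \<Rightarrow> 'a \<Rightarrow> nat \<Rightarrow> real"
    and C c\<^sub>0 b \<epsilon> :: real
    and \<nu> Mp :: "nat \<Rightarrow> real"
  assumes prob: "\<And>k. prob_space (M k)"
    and n_lim: "filterlim n at_top sequentially"
    and p_lim: "filterlim p at_top sequentially"
    and X_eq: "\<And>k i \<omega>. i < n k \<Longrightarrow> \<omega> \<in> space (M k) \<Longrightarrow>
      X k i \<omega> = (\<lambda>j\<in>{..<p k}. Y k i \<omega> j + Z k i \<omega> j / sqrt (real (p k)))"
    \<comment> \<open>(i)\<close>
    and Y_meas: "\<And>k i. i < n k \<Longrightarrow> Y k i \<in> measurable (M k) (euclid (p k))"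
    and Z_meas: "\<And>k i. i < n k \<Longrightarrow> Z k i \<in> measurable (M k) (euclid (p k))"
    and Z_indep: "\<And>k. prob_space.indep_vars (M k) (\<lambda>_. euclid (p k)) (Z k) {..<n k}"
    and Z_ident: "\<And>k i j. i < n k \<Longrightarrow> j < n k \<Longrightarrow>
      distr (M k) (euclid (p k)) (Z k i) = distr (M k) (euclid (p k)) (Z k j)"
    and Z_integrable: "\<And>k i j. i < n k \<Longrightarrow> j < p k \<Longrightarrow> integrable (M k) (\<lambda>\<omega>. Z k i \<omega> j)"
    and Z_mean: "\<And>k i j. i < n k \<Longrightarrow> j < p k \<Longrightarrow> (\<integral>\<omega>. Z k i \<omega> j \<partial>M k) = 0"
    and YZ_indep: "\<And>k. prob_space.indep_var (M k)
      (\<Pi>\<^sub>M i\<in>{..<n k}. euclid (p k)) (\<lambda>\<omega>. \<lambda>i\<in>{..<n k}. Y k i \<omega>)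
      (\<Pi>\<^sub>M i\<in>{..<n k}. euclid (p k)) (\<lambda>\<omega>. \<lambda>i\<in>{..<n k}. Z k i \<omega>)"
    \<comment> \<open>(ii)\<close>
    and const_pos: "C > 0" "c\<^sub>0 > 0" "b > 0"
    and concentration: "\<And>k i F r. i < n k \<Longrightarrow> one_Lipschitz (p k) F \<Longrightarrow> r > 0 \<Longrightarrow>
      measure (M k) {\<omega> \<in> space (M k). \<bar>F (Z k i \<omega>) - (\<integral>\<omega>'. F (Z k i \<omega>') \<partial>M k)\<bar> > r}
        \<le> C * exp (- c\<^sub>0 * r powr b)"
    \<comment> \<open>(iii)\<close>
    and Z_sq_integrable: "\<And>k i. i < n k \<Longrightarrow>
      integrable (M k) (\<lambda>\<omega>. (L2_set (Z k i \<omega>) {..<p k})\<^sup>2)"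
    and nu_eq: "\<And>k i. i < n k \<Longrightarrow>
      \<nu> k = (\<integral>\<omega>. (L2_set (Z k i \<omega>) {..<p k})\<^sup>2 \<partial>M k) / real (p k)"
    and nu_bounded: "Bseq \<nu>"
    \<comment> \<open>(iv)\<close>
    and Mp: "(\<lambda>k. measure (M k)
      {\<omega> \<in> space (M k). max_sqdist (n k) (p k) (\<lambda>i. Y k i \<omega>) \<le> Mp k}) \<longlonglongrightarrow> 1"
    and eps: "\<epsilon> > 0"
    and Mp_lim: "(\<lambda>k. max (sqrt (Mp k)) 1 *
      ((ln (real (n k)) + ln (real (n k)) powr \<epsilon>) powr (1 / b) / sqrt (real (p k)))) \<longlonglongrightarrow> 0"
  shows "tendsto_0_in_prob M (\<lambda>k \<omega>. ereal (Max ((\<lambda>(i, j).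
           \<bar>sqdist (p k) (X k i \<omega>) (X k j \<omega>) - (sqdist (p k) (Y k i \<omega>) (Y k j \<omega>) + 2 * \<nu> k)\<bar>)
             ` offdiag (n k))))
    \<and> (\<forall>Wp :: nat \<Rightarrow> real.
        (\<lambda>k. measure (M k)
          {\<omega> \<in> space (M k). min_sqdist (n k) (p k) (\<lambda>i. Y k i \<omega>) \<ge> Wp k}) \<longlonglongrightarrow> 1 \<longrightarrow>
        (\<forall>C\<^sub>1 > 0. \<forall>\<eta> > 0.
          tendsto_0_in_outer_prob M (\<lambda>k \<omega>.
            SUP f \<in> Lipschitz_class C\<^sub>1 {Wp k + 2 * \<nu> k - \<eta> .. Mp k + 2 * \<nu> k + \<eta>}.
              ereal (frobenius_norm (n k) (\<lambda>i j.
                kernel_matrix (n k) (p k) f (\<lambda>i. X k i \<omega>) i j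
                - kernel_matrix_approx (n k) (p k) (\<nu> k) f (\<lambda>i. Y k i \<omega>) i j)))))"
proof -
  define q where "q r = C * exp (- c\<^sub>0 * r powr b)" for r
  have q_sum: "summable (\<lambda>m. (2 * real m + 1) * q (real m))"
    unfolding q_def using const_pos by (intro summable_stretched_exp) auto
  have q_nonneg: "q x \<ge> 0" for x
    using const_pos by (simp add: q_def)
  define K where "K = 1 + (\<Sum>m. (2 * real m + 1) * q (real m))"
  obtain B where B: "\<And>k. \<bar>\<nu> k\<bar> \<le> B"
    using nu_bounded by (auto simp: Bseq_def)
  \<comment> \<open>With this choice \<open>q (r k) = C / n\<^sup>3\<close>, which beats the \<open>n\<^sup>2\<close> of the union bound over pairs.\<close>
  define r where "r k = (3 / c\<^sub>0 * ln (real (n k))) powr (1 / b)" for k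
  define t where "t k = max (sqrt (Mp k)) 1 * r k / sqrt (real (p k))" for k
  define \<delta> where "\<delta> k = (4 + 6 * sqrt B) * t k + 4 * (t k)\<^sup>2 + 2 * K / real (p k)" for k
  let ?\<Delta> = "\<lambda>k \<omega>. max_deviation (n k) (p k) (\<nu> k) (\<lambda>i. X k i \<omega>) (\<lambda>i. Y k i \<omega>)"

  have n_ev: "eventually (\<lambda>k. n k \<ge> 2) sequentially"
    using n_lim by (simp add: filterlim_at_top)
  have p_ev: "eventually (\<lambda>k. p k > 0) sequentially"
    using p_lim[unfolded filterlim_at_top, rule_format, of 1] by eventually_elim simp
  have n_real: "filterlim (\<lambda>k. real (n k)) at_top sequentially"
    using filterlim_compose[OF filterlim_real_sequentially n_lim] .
  have p_real: "filterlim (\<lambda>k. real (p k)) at_top sequentially"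
    using filterlim_compose[OF filterlim_real_sequentially p_lim] .

  have X_meas: "X k i \<in> measurable (M k) (euclid (p k))" if "i < n k" for k i
  proof -
    note [measurable] = Y_meas[OF that] Z_meas[OF that]
    have "(\<lambda>\<omega>. \<lambda>j\<in>{..<p k}. Y k i \<omega> j + Z k i \<omega> j / sqrt (real (p k)))
        \<in> measurable (M k) (euclid (p k))"
      by (intro measurable_restrict) measurable
    then show ?thesis
      by (rule measurable_cong[THEN iffD1, rotated]) (simp add: X_eq[OF that])
  qed
  have \<Delta>_meas: "?\<Delta> k \<in> borel_measurable (M k)" for k
    using X_meas Y_meas by (rule measurable_max_deviation)
  have max_meas: "(\<lambda>\<omega>. max_sqdist (n k) (p k) (\<lambda>i. Y k i \<omega>)) \<in> borel_measurable (M k)" for k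
    using Y_meas by (rule measurable_max_sqdist)
  have min_meas: "(\<lambda>\<omega>. min_sqdist (n k) (p k) (\<lambda>i. Y k i \<omega>)) \<in> borel_measurable (M k)" for k
    using Y_meas by (rule measurable_min_sqdist)

  have t_lim: "t \<longlonglongrightarrow> 0"
  proof (rule Lim_null_comparison)
    let ?u = "\<lambda>k. (3 / c\<^sub>0) powr (1 / b) * (max (sqrt (Mp k)) 1 *
      ((ln (real (n k)) + ln (real (n k)) powr \<epsilon>) powr (1 / b) / sqrt (real (p k))))"
    show "?u \<longlonglongrightarrow> 0"
      using tendsto_mult_right_zero[OF Mp_lim] .
    show "eventually (\<lambda>k. norm (t k) \<le> ?u k) sequentially"
      using n_ev
    proof eventually_elim
      case (elim k)
      then have ln: "ln (real (n k)) \<ge> 0" by simp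
      have "r k = (3 / c\<^sub>0) powr (1 / b) * ln (real (n k)) powr (1 / b)"
        unfolding r_def using ln const_pos by (subst powr_mult) auto
      also have "\<dots> \<le> (3 / c\<^sub>0) powr (1 / b)
          * (ln (real (n k)) + ln (real (n k)) powr \<epsilon>) powr (1 / b)"
        using ln const_pos by (intro mult_left_mono powr_mono2) auto
      finally have "t k \<le> max (sqrt (Mp k)) 1 * ((3 / c\<^sub>0) powr (1 / b)
          * (ln (real (n k)) + ln (real (n k)) powr \<epsilon>) powr (1 / b)) / sqrt (real (p k))"
        unfolding t_def by (intro divide_right_mono mult_left_mono) auto
      moreover have "t k \<ge> 0" unfolding t_def r_def by simp
      ultimately show ?case by (simp add: mult_ac)
    qed
  qed
  have \<delta>_lim: "\<delta> \<longlonglongrightarrow> 0"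
  proof -
    have "(\<lambda>k. 2 * K / real (p k)) \<longlonglongrightarrow> 0"
      using p_real by (rule real_tendsto_divide_at_top[OF tendsto_const])
    from tendsto_add[OF tendsto_add[OF tendsto_mult[OF tendsto_const t_lim, of "4 + 6 * sqrt B"]
          tendsto_mult[OF tendsto_const tendsto_power[OF t_lim, of 2], of 4]] this]
    show ?thesis unfolding \<delta>_def by simp
  qed

  define g where "g k = (1 - measure (M k)
    {\<omega> \<in> space (M k). max_sqdist (n k) (p k) (\<lambda>i. Y k i \<omega>) \<le> Mp k}) + 3 * C / real (n k)" for k
  have g_lim: "g \<longlonglongrightarrow> 0"
  proof -
    have "(\<lambda>k. 3 * C / real (n k)) \<longlonglongrightarrow> 0"
      using n_real by (rule real_tendsto_divide_at_top[OF tendsto_const])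
    from tendsto_add[OF tendsto_diff[OF tendsto_const[of 1] Mp] this]
    show ?thesis unfolding g_def by simp
  qed
  have key: "eventually (\<lambda>k. measure (M k) {\<omega> \<in> space (M k). ?\<Delta> k \<omega> > \<delta> k} \<le> g k) sequentially"
    using n_ev p_ev
  proof eventually_elim
    case (elim k)
    interpret prob_space "M k" by (rule prob)
    have r: "r k > 0" using elim(1) const_pos unfolding r_def by simp
    have "prob {\<omega> \<in> space (M k). ?\<Delta> k \<omega> > \<delta> k}
        \<le> prob {\<omega> \<in> space (M k). \<not> max_sqdist (n k) (p k) (\<lambda>i. Y k i \<omega>) \<le> Mp k}
          + 3 * (real (n k))\<^sup>2 * q (r k)"
      unfolding \<delta>_def t_def K_def
    proof (rule max_deviation_prob_le[where Z = "Z k" and q = q])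
      show "n k \<ge> 2" "p k > 0" "r k > 0" by fact+
      show "X k i \<omega> l = Y k i \<omega> l + Z k i \<omega> l / sqrt (real (p k))"
        if "i < n k" "\<omega> \<in> space (M k)" "l < p k" for i l \<omega>
        using X_eq[OF that(1,2)] that(3) by simp
      show "indep_var (euclid (p k)) (\<lambda>\<omega>. \<lambda>l\<in>{..<p k}. Y k i \<omega> l - Y k j \<omega> l)
          (euclid (p k)) (Z k i)" if "i < n k" "j < n k" for i j
        using that by (intro indep_var_diff_component[OF YZ_indep]) auto
      show "indep_var (euclid (p k)) (Z k i) (euclid (p k)) (Z k j)"
        if "i < n k" "j < n k" "i \<noteq> j" for i j
        using that by (intro indep_var_pair[OF Z_indep]) auto
      show "lip_conc (p k) q (Z k i)" if "i < n k" for i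
        unfolding lip_conc_def q_def using concentration[OF that] by blast
      show "expectation (\<lambda>\<omega>. (enorm (p k) (Z k i \<omega>))\<^sup>2) = real (p k) * \<nu> k" if "i < n k" for i
        using nu_eq[OF that] elim(2) by simp
      show "\<nu> k \<le> B" using B[of k] by simp
      show "q 0 \<ge> 0" by (rule q_nonneg)
    qed (use Y_meas Z_meas Z_integrable Z_mean Z_sq_integrable q_sum in auto)
    also have "3 * (real (n k))\<^sup>2 * q (r k) = 3 * C / real (n k)"
    proof -
      have "r k powr b = 3 / c\<^sub>0 * ln (real (n k))"
        using elim(1) const_pos by (simp add: r_def powr_powr)
      then have "q (r k) = C * exp (- (3 * ln (real (n k))))"
        using const_pos by (simp add: q_def)
      also have "exp (- (3 * ln (real (n k)))) = 1 / real (n k) ^ 3"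
        using elim(1) exp_of_nat_mult[of 3 "ln (real (n k))"] by (simp add: exp_minus inverse_eq_divide)
      finally show ?thesis using elim(1) by (simp add: power2_eq_square power3_eq_cube)
    qed
    also have "prob {\<omega> \<in> space (M k). \<not> max_sqdist (n k) (p k) (\<lambda>i. Y k i \<omega>) \<le> Mp k}
        = 1 - prob {\<omega> \<in> space (M k). max_sqdist (n k) (p k) (\<lambda>i. Y k i \<omega>) \<le> Mp k}"
      using max_meas[of k] by (intro prob_neg) measurable
    finally show ?case unfolding g_def .
  qed
  have dev: "eventually (\<lambda>k. measure (M k) {\<omega> \<in> space (M k). ?\<Delta> k \<omega> > e} \<le> g k) sequentially"
    if "e > 0" for e
    using key order_tendstoD(2)[OF \<delta>_lim that]
  proof eventually_elim
    case (elim k)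
    interpret prob_space "M k" by (rule prob)
    have "prob {\<omega> \<in> space (M k). ?\<Delta> k \<omega> > e} \<le> prob {\<omega> \<in> space (M k). ?\<Delta> k \<omega> > \<delta> k}"
      using \<Delta>_meas[of k] elim(2) by (intro finite_measure_mono) auto
    with elim(1) show ?case by simp
  qed

  show ?thesis
  proof (intro conjI allI impI)
    have "tendsto_0_in_prob M (\<lambda>k \<omega>. ereal (?\<Delta> k \<omega>))"
    proof (rule tendsto_0_in_probI)
      show "(\<lambda>\<omega>. ereal (?\<Delta> k \<omega>)) \<in> borel_measurable (M k)" for k
        using \<Delta>_meas by simp
      show "g \<longlonglongrightarrow> 0" by (rule g_lim)
      fix e :: real assume "e > 0"
      show "eventually (\<lambda>k. measure (M k)
          {\<omega> \<in> space (M k). \<bar>ereal (?\<Delta> k \<omega>)\<bar> > ereal e} \<le> g k) sequentially"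
        using dev[OF \<open>e > 0\<close>] n_ev
        by eventually_elim (simp add: max_deviation_nonneg)
    qed
    then show "tendsto_0_in_prob M (\<lambda>k \<omega>. ereal (Max ((\<lambda>(i, j).
        \<bar>sqdist (p k) (X k i \<omega>) (X k j \<omega>) - (sqdist (p k) (Y k i \<omega>) (Y k j \<omega>) + 2 * \<nu> k)\<bar>)
          ` offdiag (n k))))"
      unfolding max_deviation_def .
  next
    fix Wp :: "nat \<Rightarrow> real" and C\<^sub>1 \<eta> :: real
    assume Wp: "(\<lambda>k. measure (M k)
        {\<omega> \<in> space (M k). min_sqdist (n k) (p k) (\<lambda>i. Y k i \<omega>) \<ge> Wp k}) \<longlonglongrightarrow> 1"
      and C1: "C\<^sub>1 > 0" and \<eta>: "\<eta> > 0"
    let ?max = "\<lambda>k \<omega>. max_sqdist (n k) (p k) (\<lambda>i. Y k i \<omega>)"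
    let ?min = "\<lambda>k \<omega>. min_sqdist (n k) (p k) (\<lambda>i. Y k i \<omega>)"
    \<comment> \<open>The absolute value makes \<open>D\<close> nonnegative when \<open>n k < 2\<close>, where \<open>?\<Delta>\<close> may be negative.\<close>
    define D where "D k \<omega> = (if ?\<Delta> k \<omega> \<le> \<eta> \<and> ?max k \<omega> \<le> Mp k \<and> ?min k \<omega> \<ge> Wp k
      then ereal (C\<^sub>1 * \<bar>?\<Delta> k \<omega>\<bar>) else \<infinity>)" for k \<omega>
    define h where "h k = g k + (1 - measure (M k) {\<omega> \<in> space (M k). ?max k \<omega> \<le> Mp k})
      + (1 - measure (M k) {\<omega> \<in> space (M k). ?min k \<omega> \<ge> Wp k})" for k
    have "tendsto_0_in_prob M D"
    proof (rule tendsto_0_in_probI)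
      show "D k \<in> borel_measurable (M k)" for k
      proof -
        note [measurable] = \<Delta>_meas[of k] max_meas[of k] min_meas[of k]
        show ?thesis unfolding D_def by measurable
      qed
      show "h \<longlonglongrightarrow> 0"
        using tendsto_add[OF tendsto_add[OF g_lim tendsto_diff[OF tendsto_const[of 1] Mp]]
            tendsto_diff[OF tendsto_const[of 1] Wp]]
        unfolding h_def by simp
      fix e :: real assume e: "e > 0"
      have "min \<eta> (e / C\<^sub>1) > 0" using \<eta> e C1 by simp
      from dev[OF this] n_ev
      show "eventually (\<lambda>k. measure (M k)
          {\<omega> \<in> space (M k). \<bar>D k \<omega>\<bar> > ereal e} \<le> h k) sequentially"
      proof eventually_elim
        case (elim k)
        interpret prob_space "M k" by (rule prob)
        note [measurable] = \<Delta>_meas[of k] max_meas[of k] min_meas[of k]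
        let ?A1 = "{\<omega> \<in> space (M k). ?\<Delta> k \<omega> > min \<eta> (e / C\<^sub>1)}"
        let ?A2 = "{\<omega> \<in> space (M k). \<not> ?max k \<omega> \<le> Mp k}"
        let ?A3 = "{\<omega> \<in> space (M k). \<not> ?min k \<omega> \<ge> Wp k}"
        have A: "?A1 \<in> events" "?A2 \<in> events" "?A3 \<in> events" by measurable
        have "{\<omega> \<in> space (M k). \<bar>D k \<omega>\<bar> > ereal e} \<subseteq> ?A1 \<union> ?A2 \<union> ?A3"
        proof
          fix \<omega> assume *: "\<omega> \<in> {\<omega> \<in> space (M k). \<bar>D k \<omega>\<bar> > ereal e}"
          show "\<omega> \<in> ?A1 \<union> ?A2 \<union> ?A3"
          proof (rule ccontr)
            assume "\<omega> \<notin> ?A1 \<union> ?A2 \<union> ?A3"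
            with * have good: "?\<Delta> k \<omega> \<le> min \<eta> (e / C\<^sub>1)" "?max k \<omega> \<le> Mp k" "?min k \<omega> \<ge> Wp k"
              by auto
            have nn: "?\<Delta> k \<omega> \<ge> 0" by (rule max_deviation_nonneg[OF elim(2)])
            have "C\<^sub>1 * ?\<Delta> k \<omega> \<le> e" using good(1) C1 by (simp add: field_simps)
            then show False using * good nn C1 by (simp add: D_def)
          qed
        qed
        then have "prob {\<omega> \<in> space (M k). \<bar>D k \<omega>\<bar> > ereal e} \<le> prob (?A1 \<union> ?A2 \<union> ?A3)"
          using A by (intro finite_measure_mono) auto
        also have "\<dots> \<le> prob (?A1 \<union> ?A2) + prob ?A3"
          using A by (intro measure_Un_le) auto
        also have "prob (?A1 \<union> ?A2) \<le> prob ?A1 + prob ?A2"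
          using A by (intro measure_Un_le) auto
        also have "prob ?A2 = 1 - prob {\<omega> \<in> space (M k). ?max k \<omega> \<le> Mp k}"
          by (intro prob_neg) measurable
        also have "prob ?A3 = 1 - prob {\<omega> \<in> space (M k). ?min k \<omega> \<ge> Wp k}"
          by (intro prob_neg) measurable
        finally show ?case using elim(1) unfolding h_def by linarith
      qed
    qed
    moreover have "(SUP f \<in> Lipschitz_class C\<^sub>1 {Wp k + 2 * \<nu> k - \<eta> .. Mp k + 2 * \<nu> k + \<eta>}.
        ereal (frobenius_norm (n k) (\<lambda>i j.
          kernel_matrix (n k) (p k) f (\<lambda>i. X k i \<omega>) i j
          - kernel_matrix_approx (n k) (p k) (\<nu> k) f (\<lambda>i. Y k i \<omega>) i j))) \<le> D k \<omega>" for k \<omega>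
    proof (rule SUP_least)
      fix f assume f: "f \<in> Lipschitz_class C\<^sub>1 {Wp k + 2 * \<nu> k - \<eta> .. Mp k + 2 * \<nu> k + \<eta>}"
      show "ereal (frobenius_norm (n k) (\<lambda>i j.
          kernel_matrix (n k) (p k) f (\<lambda>i. X k i \<omega>) i j
          - kernel_matrix_approx (n k) (p k) (\<nu> k) f (\<lambda>i. Y k i \<omega>) i j)) \<le> D k \<omega>"
        using frobenius_kernel_diff_le[OF _ _ _ f C1] by (simp add: D_def)
    qed
    ultimately show "tendsto_0_in_outer_prob M (\<lambda>k \<omega>.
        SUP f \<in> Lipschitz_class C\<^sub>1 {Wp k + 2 * \<nu> k - \<eta> .. Mp k + 2 * \<nu> k + \<eta>}.
          ereal (frobenius_norm (n k) (\<lambda>i j.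
            kernel_matrix (n k) (p k) f (\<lambda>i. X k i \<omega>) i j
            - kernel_matrix_approx (n k) (p k) (\<nu> k) f (\<lambda>i. Y k i \<omega>) i j)))"
      unfolding tendsto_0_in_outer_prob_def by blast
  qed
qed

end
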